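(* Let $|H_n^{n-1,n}\rangle=C^{\{1,\dots,n\}}\prod_{i=1}^{n} C^{\{1,\dots,n\}\setminus\{i\}}\,|+\rangle^{\otimes n}$ be the $n$-qubit hypergraph state endowed with all possible hyperedges of cardinality greater than or equal to $n-1$ (and no others). Then the maximum squared overlap between $|H_n^{n-1,n}\rangle$ and the pure biseparable states is $$\alpha(|H_3^{2,3}\rangle)=\frac34,$$ $$\alpha(|H_n^{n-1,n}\rangle)=\frac{2^{n-1}-n+1}{2^{n-1}}\quad\text{for } n\text{ even},$$ $$\alpha(|H_n^{n-1,n}\rangle)=\frac{2^{n-1}-n}{2^{n-1}}\quad\text{for } n\text{ odd},\ n\ge5.$$ The multipartite entanglement of $|H_n^{n-1,n}\rangle$ is $$E(|H_3^{2,3}\rangle)=\frac14,$$ $$E(|H_n^{n-1,n}\rangle)=\frac{n-1}{2^{n-1}}\quad\text{for } n\text{ even},$$ $$E(|H_n^{n-1,n}\rangle)=\frac{n}{2^{n-1}}\quad\text{for } n\text{ odd},\ n\ge5.$$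
   Context: Throughout, $n\ge 2$ is the number of qubits, so the Hilbert space is $(\mathbb{C}^2)^{\otimes n}$ with computational basis $|x\rangle$, $x\in\{0,1\}^n$, and $|+\rangle=(|0\rangle+|1\rangle)/\sqrt2$. For a nonempty set $e\subseteq\{1,\dots,n\}$ with $|e|=k$, $C^{e}=C_k^{e}$ is the $k$-qubit controlled-$Z$ gate acting on the qubits in $e$ (identity on the other qubits): it is the diagonal operator with $C^e|x\rangle=-|x\rangle$ if $x_j=1$ for all $j\in e$, and $C^e|x\rangle=|x\rangle$ otherwise (for $k=1$ it is the Pauli matrix $\sigma_z$ on that qubit). All these gates commute. Overlap and multipartite entanglement: for a normalized pure state $|\psi\rangle$ of $n$ qubits and a bipartition $A\,|\,B$ of the set of qubits into two nonempty disjoint sets with union $\{1,\dots,n\}$, let $\alpha^{AB}(|\psi\rangle)=\max|\langle\phi^A|\langle\phi^B|\psi\rangle|^2$, the maximum being over all normalized pure states $|\phi^A\rangle$ of the qubits in $A$ and $|\phi^B\rangle$ of the qubits in $B$. Define $\alpha(|\psi\rangle)=\max_{AB}\alpha^{AB}(|\psi\rangle)$ over all such bipartitions, and the multipartite entanglement $E(|\psi\rangle)=1-\alpha(|\psi\rangle)$. The pure biseparable states are the product states $|\phi^A\rangle|\phi^B\rangle$ over all bipartitions. *)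

theory Defs
  imports "HOL-Analysis.Analysis"
begin

text \<open>
  A computational basis label of the qubits in \<open>Q\<close> is an extensional function \<open>x\<close> on \<open>Q\<close>,
  where \<open>x j = True\<close> stands for \<open>x\<^sub>j = 1\<close>.  A vector of the register \<open>Q\<close> is the function
  of its amplitudes; only its values on \<open>labels Q\<close> are meaningful.
\<close>

type_synonym label = "nat \<Rightarrow> bool"
type_synonym qvec = "label \<Rightarrow> complex"

definition labels :: "nat set \<Rightarrow> label set" where
  "labels Q = Q \<rightarrow>\<^sub>E UNIV"

definition braket :: "nat set \<Rightarrow> qvec \<Rightarrow> qvec \<Rightarrow> complex" where
  "braket Q \<phi> \<psi> = (\<Sum>x\<in>labels Q. cnj (\<phi> x) * \<psi> x)"

definition normalized :: "nat set \<Rightarrow> qvec \<Rightarrow> bool" where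
  "normalized Q \<phi> \<longleftrightarrow> braket Q \<phi> \<phi> = 1"

definition tensor :: "nat set \<Rightarrow> nat set \<Rightarrow> qvec \<Rightarrow> qvec \<Rightarrow> qvec" where
  "tensor A B \<phi> \<eta> = (\<lambda>x. \<phi> (restrict x A) * \<eta> (restrict x B))"

definition plus_ket :: "bool \<Rightarrow> complex" where
  "plus_ket b = 1 / complex_of_real (sqrt 2)"

definition plus_state :: "nat \<Rightarrow> qvec" where
  "plus_state n = (\<lambda>x. \<Prod>j\<in>{1..n}. plus_ket (x j))"

definition CZ :: "nat set \<Rightarrow> qvec \<Rightarrow> qvec" where
  "CZ e \<psi> = (\<lambda>x. if \<forall>j\<in>e. x j then - \<psi> x else \<psi> x)"

text \<open>The gates commute, so the order in which \<open>foldr\<close> composes them is immaterial.\<close>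

definition hypergraph_state :: "nat \<Rightarrow> qvec" where
  "hypergraph_state n =
     CZ {1..n} (foldr (\<lambda>i. CZ ({1..n} - {i})) [1..<Suc n] (plus_state n))"

definition bipartition :: "nat \<Rightarrow> nat set \<Rightarrow> nat set \<Rightarrow> bool" where
  "bipartition n A B \<longleftrightarrow> A \<noteq> {} \<and> B \<noteq> {} \<and> A \<inter> B = {} \<and> A \<union> B = {1..n}"

definition overlaps :: "nat set \<Rightarrow> nat set \<Rightarrow> qvec \<Rightarrow> real set" where
  "overlaps A B \<psi> =
     {(cmod (braket (A \<union> B) (tensor A B \<phi> \<eta>) \<psi>))\<^sup>2 | \<phi> \<eta>. normalized A \<phi> \<and> normalized B \<eta>}"

text \<open>The supremum is a maximum; see \<open>overlap_max_attained\<close> below.\<close>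

definition overlap_max :: "nat set \<Rightarrow> nat set \<Rightarrow> qvec \<Rightarrow> real" where
  "overlap_max A B \<psi> = Sup (overlaps A B \<psi>)"

definition alpha :: "nat \<Rightarrow> qvec \<Rightarrow> real" where
  "alpha n \<psi> = Max {overlap_max A B \<psi> | A B. bipartition n A B}"

definition entanglement :: "nat \<Rightarrow> qvec \<Rightarrow> real" where
  "entanglement n \<psi> = 1 - alpha n \<psi>"

lemma finite_labels [simp]: "finite Q \<Longrightarrow> finite (labels Q)"
  unfolding labels_def by (rule finite_PiE) auto

lemma normalized_iff: "normalized Q \<phi> \<longleftrightarrow> (\<Sum>x\<in>labels Q. (cmod (\<phi> x))\<^sup>2) = 1"
proof -
  have "braket Q \<phi> \<phi> = complex_of_real (\<Sum>x\<in>labels Q. (cmod (\<phi> x))\<^sup>2)"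
    unfolding braket_def of_real_sum
    by (intro sum.cong refl) (metis complex_norm_square mult.commute)
  then show ?thesis unfolding normalized_def by (metis of_real_eq_1_iff)
qed

definition sphere_on :: "nat set \<Rightarrow> qvec set" where
  "sphere_on Q = {\<phi>. normalized Q \<phi> \<and> (\<forall>x. x \<notin> labels Q \<longrightarrow> \<phi> x = 0)}"

lemma compact_sphere_on:
  assumes "finite Q"
  shows "compact (sphere_on Q)"
proof -
  define K where "K = (\<Pi>\<^sub>E x\<in>UNIV. if x \<in> labels Q then cball (0::complex) 1 else {0})"
  have "compactin (product_topology (\<lambda>_. euclidean) UNIV) K"
    unfolding K_def compactin_PiE by simp
  then have K: "compact K"
    by (simp only: euclidean_product_topology compactin_euclidean_iff)
  have cl: "closed {\<phi>::qvec. (\<Sum>x\<in>labels Q. (cmod (\<phi> x))\<^sup>2) = 1}"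
    by (intro closed_Collect_eq continuous_intros continuous_on_product_coordinates)
  have "cmod (\<phi> x) \<le> 1" if "normalized Q \<phi>" "x \<in> labels Q" for \<phi> x
  proof -
    have "(cmod (\<phi> x))\<^sup>2 \<le> (\<Sum>x\<in>labels Q. (cmod (\<phi> x))\<^sup>2)"
      using that assms by (intro member_le_sum) auto
    then show ?thesis using that by (simp add: normalized_iff power_le_one_iff)
  qed
  then have "sphere_on Q = K \<inter> {\<phi>. (\<Sum>x\<in>labels Q. (cmod (\<phi> x))\<^sup>2) = 1}"
    unfolding sphere_on_def K_def
    by (auto simp: normalized_iff PiE_iff split: if_splits)
  then show ?thesis using K cl by (simp add: compact_Int_closed)
qed

lemma sphere_on_nonempty:
  assumes "finite Q"
  shows "sphere_on Q \<noteq> {}"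
proof -
  define y :: label where "y = (\<lambda>j. if j \<in> Q then False else undefined)"
  have y: "y \<in> labels Q" by (auto simp: labels_def y_def)
  have "(\<Sum>x\<in>labels Q. (cmod (if x = y then 1 else 0))\<^sup>2)
      = (\<Sum>x\<in>labels Q. if x = y then 1 else (0::real))"
    by (rule sum.cong) auto
  then have "(\<lambda>x. if x = y then 1 else 0) \<in> sphere_on Q"
    using y assms by (auto simp: sphere_on_def normalized_iff)
  then show ?thesis by blast
qed

lemma overlap_max_attained:
  assumes "finite A" "finite B"
  shows "overlap_max A B \<psi> \<in> overlaps A B \<psi>"
    and "v \<in> overlaps A B \<psi> \<Longrightarrow> v \<le> overlap_max A B \<psi>"
proof -
  define F where "F = (\<lambda>p. (cmod (braket (A \<union> B) (tensor A B (fst p) (snd p)) \<psi>))\<^sup>2)"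
  have cont: "continuous_on (sphere_on A \<times> sphere_on B) F"
    unfolding F_def braket_def tensor_def
    by (intro continuous_intros continuous_on_product_then_coordinatewise[OF continuous_on_fst]
        continuous_on_product_then_coordinatewise[OF continuous_on_snd])
  have "compact (sphere_on A \<times> sphere_on B)"
    using assms by (intro compact_Times compact_sphere_on)
  then obtain p where p: "p \<in> sphere_on A \<times> sphere_on B"
    and pmax: "\<And>q. q \<in> sphere_on A \<times> sphere_on B \<Longrightarrow> F q \<le> F p"
    using continuous_attains_sup[OF _ _ cont] sphere_on_nonempty[OF assms(1)]
      sphere_on_nonempty[OF assms(2)] by blast
  have F_in: "F p \<in> overlaps A B \<psi>"
    using p unfolding overlaps_def F_def sphere_on_def by (cases p) auto
  have ub: "v \<le> F p" if "v \<in> overlaps A B \<psi>" for v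
  proof -
    from that obtain \<phi> \<eta> where v: "v = (cmod (braket (A \<union> B) (tensor A B \<phi> \<eta>) \<psi>))\<^sup>2"
      and nrm: "normalized A \<phi>" "normalized B \<eta>" unfolding overlaps_def by blast
    define \<phi>' where "\<phi>' = (\<lambda>x. if x \<in> labels A then \<phi> x else 0)"
    define \<eta>' where "\<eta>' = (\<lambda>x. if x \<in> labels B then \<eta> x else 0)"
    have "tensor A B \<phi>' \<eta>' = tensor A B \<phi> \<eta>"
      by (auto simp: tensor_def \<phi>'_def \<eta>'_def labels_def)
    moreover have "\<phi>' \<in> sphere_on A" "\<eta>' \<in> sphere_on B"
      using nrm by (auto simp: sphere_on_def normalized_iff \<phi>'_def \<eta>'_def)
    ultimately show ?thesis using pmax[of "(\<phi>', \<eta>')"] by (simp add: F_def v)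
  qed
  have "Sup (overlaps A B \<psi>) = F p" using F_in ub by (intro cSup_eq_maximum)
  then show "overlap_max A B \<psi> \<in> overlaps A B \<psi>"
    and "v \<in> overlaps A B \<psi> \<Longrightarrow> v \<le> overlap_max A B \<psi>"
    using F_in ub by (auto simp: overlap_max_def)
qed

end

theory Submission
  imports Defs
begin

text \<open>
  Across a bipartition \<open>A | B\<close> the state is, up to the factor \<open>2\<^sup>-\<^sup>n\<^sup>/\<^sup>2\<close>, a sign matrix \<open>S\<close> with rows
  \<open>labels A\<close> and columns \<open>labels B\<close>, and \<open>1 - \<alpha>\<close> is the least squared distance of the normalized
  matrix from a rank one matrix.  A 2 by 2 sign matrix with an odd number of entries \<open>-1\<close> has squared
  distance at least 2 from the rank one matrices, so \<open>m\<close> disjoint submatrices of this kind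
  give \<open>1 - \<alpha> \<ge> 2 m / 2\<^sup>n\<close>.  The entries \<open>-1\<close> of \<open>S\<close> lie in the cross formed by the all-ones
  row and column, and every bipartition admits \<open>m = n - 1\<close> (\<open>n\<close> even), \<open>m = n\<close> (\<open>n \<ge> 5\<close> odd) or
  \<open>m = 1\<close> (\<open>n = 3\<close>) such submatrices.  Splitting off one qubit attains the bound: there \<open>S\<close>
  has two rows, and its best rank one approximation is supported on the columns where they agree,
  or where they disagree if \<open>n = 3\<close>.
\<close>

section \<open>Distance of sign matrices from rank one matrices\<close>

lemma cmod_diff_sign:
  assumes "p = 1 \<or> p = -1"
  shows "(cmod (complex_of_real p - z))\<^sup>2 = 1 - 2 * Re (p * z) + (cmod z)\<^sup>2"
  using assms unfolding cmod_power2
  by (elim disjE) (simp_all add: power2_eq_square algebra_simps)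

text \<open>An odd number of entries -1 makes the two columns of the sign matrix orthogonal, so both
  of its singular values are sqrt 2, and the squared distance to rank one is at least the square of
  the smaller one. The proof makes this explicit by writing twice the distance as 4 plus two
  squares.\<close>

lemma odd_sign_block_distance:
  fixes x x' y y' :: complex and p q r s :: real
  assumes signs: "p = 1 \<or> p = -1" "q = 1 \<or> q = -1" "r = 1 \<or> r = -1" "s = 1 \<or> s = -1"
    and odd: "p * q * r * s = -1"
  shows "2 \<le> (cmod (p - x * y))\<^sup>2 + (cmod (q - x * y'))\<^sup>2
            + (cmod (r - x' * y))\<^sup>2 + (cmod (s - x' * y'))\<^sup>2" (is "2 \<le> ?d")
proof -
  define u v where "u = p * y + q * y'" and "v = r * y + s * y'"
  \<comment> \<open>The oddness gives p q + r s = 0, which cancels the mixed terms in y and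
    y'.\<close>
  have "(cmod u)\<^sup>2 + (cmod v)\<^sup>2 = 2 * ((cmod y)\<^sup>2 + (cmod y')\<^sup>2)"
    using signs odd unfolding u_def v_def cmod_power2
    by (elim disjE) (simp_all add: power2_eq_square algebra_simps)
  \<comment> \<open>Lagrange's identity for the vectors (x, x') and (u, v).\<close>
  moreover have "((cmod x)\<^sup>2 + (cmod x')\<^sup>2) * ((cmod u)\<^sup>2 + (cmod v)\<^sup>2)
      = (cmod (x * u + x' * v))\<^sup>2 + (cmod (x * cnj v - x' * cnj u))\<^sup>2"
    unfolding cmod_power2 by (simp add: power2_eq_square algebra_simps)
  moreover have "?d = 4 - 2 * Re (x * u + x' * v)
      + ((cmod x)\<^sup>2 + (cmod x')\<^sup>2) * ((cmod y)\<^sup>2 + (cmod y')\<^sup>2)"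
    unfolding cmod_diff_sign[OF signs(1)] cmod_diff_sign[OF signs(2)]
      cmod_diff_sign[OF signs(3)] cmod_diff_sign[OF signs(4)]
    by (simp add: u_def v_def norm_mult power_mult_distrib algebra_simps)
  moreover have "(cmod (x * u + x' * v - 2))\<^sup>2
      = (cmod (x * u + x' * v))\<^sup>2 - 4 * Re (x * u + x' * v) + 4"
    unfolding cmod_power2 by (simp add: power2_eq_square algebra_simps)
  ultimately have "2 * ?d = 4 + (cmod (x * u + x' * v - 2))\<^sup>2 + (cmod (x * cnj v - x' * cnj u))\<^sup>2"
    by (simp only: distrib_left mult.left_commute[of 2]) simp
  moreover have "2 \<le> t" if "2 * t = 4 + a\<^sup>2 + b\<^sup>2" for t a b :: real
    using that zero_le_power2[of a] zero_le_power2[of b] by linarith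
  ultimately show ?thesis by blast
qed

definition cells :: "'r \<times> 'r \<times> 'c \<times> 'c \<Rightarrow> ('r \<times> 'c) set" where
  "cells = (\<lambda>(r, r', c, c'). {r, r'} \<times> {c, c'})"

definition odd_block :: "('r \<Rightarrow> 'c \<Rightarrow> real) \<Rightarrow> 'r \<times> 'r \<times> 'c \<times> 'c \<Rightarrow> bool" where
  "odd_block S = (\<lambda>(r, r', c, c'). r \<noteq> r' \<and> c \<noteq> c' \<and> S r c * S r c' * S r' c * S r' c' = -1)"

text \<open>Disjointness concerns matrix entries only: two blocks may share rows or share
  columns.\<close>

definition has_odd_blocks :: "('r \<Rightarrow> 'c \<Rightarrow> real) \<Rightarrow> 'r set \<Rightarrow> 'c set \<Rightarrow> nat \<Rightarrow> bool" where
  "has_odd_blocks S R C m \<longleftrightarrow> (\<exists>T. finite T \<and> card T = m \<and> disjoint_family_on cells T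
     \<and> (\<forall>q\<in>T. odd_block S q \<and> cells q \<subseteq> R \<times> C))"

text \<open>With w the overlap, the matrix w \<phi> \<eta> is the orthogonal projection of S onto
  the line spanned by the unit vector \<phi> \<eta>. By Pythagoras its squared distance from S is
  |R| |C| - |w|^2. This distance is a sum over entries, and each odd block contributes at least 2 to
  it.\<close>

lemma product_overlap_le:
  fixes \<phi> :: "'r \<Rightarrow> complex" and \<eta> :: "'c \<Rightarrow> complex" and S :: "'r \<Rightarrow> 'c \<Rightarrow> real"
  assumes fin: "finite R" "finite C"
    and S: "\<And>r c. S r c = 1 \<or> S r c = -1"
    and \<phi>: "(\<Sum>r\<in>R. (cmod (\<phi> r))\<^sup>2) = 1" and \<eta>: "(\<Sum>c\<in>C. (cmod (\<eta> c))\<^sup>2) = 1"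
    and blocks: "has_odd_blocks S R C m"
  shows "(cmod (\<Sum>(r, c)\<in>R \<times> C. cnj (\<phi> r * \<eta> c) * S r c))\<^sup>2 \<le> card R * card C - 2 * real m"
proof -
  define w where "w = (\<Sum>(r, c)\<in>R \<times> C. cnj (\<phi> r * \<eta> c) * S r c)"
  define d where "d = (\<lambda>(r, c). (cmod (S r c - w * \<phi> r * \<eta> c))\<^sup>2)"
  have S2: "S r c * S r c = 1" for r c using S[of r c] by auto
  have d: "d (r, c) = 1 - 2 * Re (cnj w * (cnj (\<phi> r * \<eta> c) * S r c))
      + (cmod w)\<^sup>2 * ((cmod (\<phi> r))\<^sup>2 * (cmod (\<eta> c))\<^sup>2)" for r c
  proof -
    have *: "(cmod (of_real t - z))\<^sup>2 = t * t - 2 * Re (cnj z * t) + (cmod z)\<^sup>2" for t z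
      unfolding cmod_power2 by (simp add: power2_eq_square algebra_simps)
    show ?thesis unfolding d_def
      by (simp add: * S2 norm_mult power_mult_distrib mult.assoc)
  qed
  have "(\<Sum>(r, c)\<in>R \<times> C. (cmod (\<phi> r))\<^sup>2 * (cmod (\<eta> c))\<^sup>2) = 1"
    using \<phi> \<eta> by (simp add: sum.cartesian_product[symmetric] sum_product[symmetric])
  moreover have "(\<Sum>(r, c)\<in>R \<times> C. Re (cnj w * (cnj (\<phi> r * \<eta> c) * S r c))) = (cmod w)\<^sup>2"
  proof -
    have "(\<Sum>(r, c)\<in>R \<times> C. Re (cnj w * (cnj (\<phi> r * \<eta> c) * S r c))) = Re (cnj w * w)"
      by (subst (2) w_def) (simp only: Re_sum sum_distrib_left case_prod_unfold)
    also have "\<dots> = (cmod w)\<^sup>2" unfolding cmod_power2 by (simp add: power2_eq_square)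
    finally show ?thesis .
  qed
  moreover have "(\<Sum>z\<in>R \<times> C. d z) = card (R \<times> C)
      - 2 * (\<Sum>(r, c)\<in>R \<times> C. Re (cnj w * (cnj (\<phi> r * \<eta> c) * S r c)))
      + (cmod w)\<^sup>2 * (\<Sum>(r, c)\<in>R \<times> C. (cmod (\<phi> r))\<^sup>2 * (cmod (\<eta> c))\<^sup>2)"
  proof -
    have "(\<Sum>z\<in>R \<times> C. d z) = (\<Sum>(r, c)\<in>R \<times> C. 1 - 2 * Re (cnj w * (cnj (\<phi> r * \<eta> c) * S r c))
      + (cmod w)\<^sup>2 * ((cmod (\<phi> r))\<^sup>2 * (cmod (\<eta> c))\<^sup>2))"
      by (rule sum.cong) (auto simp only: d)
    then show ?thesis
      by (simp only: case_prod_unfold sum.distrib sum_subtractf sum_distrib_left[symmetric]) simp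
  qed
  ultimately have total: "(\<Sum>z\<in>R \<times> C. d z) = card R * card C - (cmod w)\<^sup>2"
    by (simp add: card_cartesian_product)
  obtain T where T: "finite T" "card T = m" "disjoint_family_on cells T"
    and odd: "\<And>q. q \<in> T \<Longrightarrow> odd_block S q" and sub: "\<And>q. q \<in> T \<Longrightarrow> cells q \<subseteq> R \<times> C"
    using blocks unfolding has_odd_blocks_def by blast
  have block: "2 \<le> (\<Sum>z\<in>cells q. d z)" if "q \<in> T" for q
  proof -
    obtain r r' c c' where q: "q = (r, r', c, c')" by (cases q)
    have ne: "r \<noteq> r'" "c \<noteq> c'" and prod: "S r c * S r c' * S r' c * S r' c' = -1"
      using odd[OF that] by (simp_all add: q odd_block_def)
    have "(\<Sum>z\<in>cells q. d z) = d (r, c) + d (r, c') + d (r', c) + d (r', c')"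
      using ne by (simp add: q cells_def sum.cartesian_product[symmetric])
    \<comment> \<open>The scalar w is absorbed into the row vector to obtain the form x y of the
      block bound.\<close>
    then show ?thesis
      using odd_sign_block_distance[OF S S S S prod, of "w * \<phi> r" "\<eta> c" "\<eta> c'" "w * \<phi> r'"]
      by (simp add: d_def)
  qed
  have "2 * real m \<le> (\<Sum>q\<in>T. \<Sum>z\<in>cells q. d z)"
    using sum_mono[of T "\<lambda>_. 2" "\<lambda>q. \<Sum>z\<in>cells q. d z", OF block] T(2)
    by (simp add: mult.commute)
  also have "\<dots> = (\<Sum>z\<in>(\<Union>q\<in>T. cells q). d z)"
    using T(1,3) by (intro sum.UNION_disjoint[symmetric])
      (auto simp: cells_def disjoint_family_on_def split: prod.splits)
  also have "\<dots> \<le> (\<Sum>z\<in>R \<times> C. d z)"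
  proof (rule sum_mono2)
    show "(\<Union>q\<in>T. cells q) \<subseteq> R \<times> C" by (rule UN_least) (rule sub)
  qed (use fin in \<open>auto simp: d_def\<close>)
  finally show ?thesis using total by (simp add: w_def)
qed

section \<open>Disjoint odd blocks in a cross-shaped sign pattern\<close>

text \<open>
  In a bipartition, the rows in \<open>E\<close> and the columns in \<open>F\<close> are the labels with exactly one 0,
  \<open>a\<close> and \<open>b\<close> are the all-ones labels, and \<open>ev\<close> is the parity of the number of qubits.
\<close>

definition cross_sign :: "bool \<Rightarrow> 'r set \<Rightarrow> 'r \<Rightarrow> 'c set \<Rightarrow> 'c \<Rightarrow> 'r \<Rightarrow> 'c \<Rightarrow> real" where
  "cross_sign ev E a F b r c =
     (if r \<in> E \<and> c = b \<or> r = a \<and> c \<in> F \<or> ev \<and> r = a \<and> c = b then -1 else 1)"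

lemma cross_sign_cases: "cross_sign ev E a F b r c = 1 \<or> cross_sign ev E a F b r c = -1"
  by (simp add: cross_sign_def)

text \<open>Each chosen block contains exactly one entry -1. For e in \<open>E'\<close> it is (e,
  b), completed by a private row \<open>g e\<close> and a common spare column \<open>b0\<close>; for
  f in F it is (a, f), completed by a private column \<open>h f\<close> and a common row
  \<open>a0\<close>. Blocks of the first kind have disjoint rows, those of the second kind disjoint
  columns, and {b, b0} misses all columns of the second kind. The bound on \<open>card C\<close>
  leaves room for F, its image under h, b and \<open>b0\<close>.\<close>

lemma has_odd_blocks_cross_sign:
  assumes fin: "finite R" "finite C"
    and E: "E \<subseteq> R" "a \<in> R" "a \<notin> E" "E \<noteq> {}" and F: "F \<subseteq> C" "b \<in> C" "b \<notin> F"
    and E': "E' \<subseteq> E" "card E' \<le> card (R - E - (if ev then {a} else {}))"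
    and C: "2 * card F + 2 \<le> card C"
  shows "has_odd_blocks (cross_sign ev E a F b) R C (card E' + card F)"
proof -
  have finE: "finite E'" "finite E" and finF: "finite F"
    using fin E E' F by (auto dest: finite_subset)
  \<comment> \<open>For \<open>ev\<close> the entry (a, b) is also -1, so a partner row a would make
    the block even.\<close>
  obtain g where g: "g ` E' \<subseteq> R - E - (if ev then {a} else {})" "inj_on g E'"
    using card_le_inj[OF finE(1) _ E'(2)] fin by blast
  have cardC: "card (C - F - {b}) = card C - card F - 1"
    using fin F finF by (simp add: card_Diff_subset)
  then obtain h where h: "h ` F \<subseteq> C - F - {b}" "inj_on h F"
    using card_le_inj[of F "C - F - {b}"] fin finF C by fastforce
  have "card (h ` F) < card (C - F - {b})"
    using cardC C card_image[OF h(2)] by linarith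
  then obtain b0 where b0: "b0 \<in> C" "b0 \<notin> F" "b0 \<noteq> b" "b0 \<notin> h ` F"
    by (metis Diff_iff card_mono finF finite_imageI linorder_not_le singletonI subsetI)
  obtain a0 where a0: "a0 \<in> R" "a0 \<noteq> a" using E by blast
  define T where "T = (\<lambda>e. (e, g e, b, b0)) ` E' \<union> (\<lambda>f. (a, a0, f, h f)) ` F"
  have "card T = card E' + card F"
    unfolding T_def using finE finF F
    by (subst card_Un_disjoint) (auto simp: card_image inj_on_def)
  moreover have "disjoint_family_on cells T"
  proof -
    have E_eq: "e = e'" if "e \<in> E'" "e' \<in> E'" "{e, g e} \<inter> {e', g e'} \<noteq> {}" for e e'
      using that g E' by (auto dest: inj_onD)
    have F_eq: "f = f'" if "f \<in> F" "f' \<in> F" "{f, h f} \<inter> {f', h f'} \<noteq> {}" for f f'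
      using that h by (auto dest: inj_onD)
    have EF: "{b, b0} \<inter> {f, h f} = {}" if "f \<in> F" for f
      using that b0 h F by auto
    have "q = q'" if q: "q \<in> T" "q' \<in> T" and meet: "cells q \<inter> cells q' \<noteq> {}" for q q'
    proof -
      consider e e' where "e \<in> E'" "e' \<in> E'" "q = (e, g e, b, b0)" "q' = (e', g e', b, b0)"
        | e f where "f \<in> F" "q = (e, g e, b, b0)" "q' = (a, a0, f, h f)"
        | e f where "f \<in> F" "q = (a, a0, f, h f)" "q' = (e, g e, b, b0)"
        | f f' where "f \<in> F" "f' \<in> F" "q = (a, a0, f, h f)" "q' = (a, a0, f', h f')"
        using q unfolding T_def by blast
      then show ?thesis
      proof cases
        case (1 e e')
        have "{e, g e} \<inter> {e', g e'} \<noteq> {}"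
          using meet unfolding 1(3,4) cells_def by blast
        then have "e = e'" by (rule E_eq[OF 1(1,2)])
        then show ?thesis unfolding 1(3,4) by simp
      next
        case (2 e f)
        show ?thesis using meet EF[OF 2(1)] unfolding 2(2,3) cells_def by blast
      next
        case (3 e f)
        show ?thesis using meet EF[OF 3(1)] unfolding 3(2,3) cells_def by blast
      next
        case (4 f f')
        have "{f, h f} \<inter> {f', h f'} \<noteq> {}"
          using meet unfolding 4(3,4) cells_def by blast
        then have "f = f'" by (rule F_eq[OF 4(1,2)])
        then show ?thesis unfolding 4(3,4) by simp
      qed
    qed
    then show ?thesis unfolding disjoint_family_on_def by blast
  qed
  moreover have "odd_block (cross_sign ev E a F b) q \<and> cells q \<subseteq> R \<times> C" if "q \<in> T" for q
    using that unfolding T_def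
  proof
    assume "q \<in> (\<lambda>e. (e, g e, b, b0)) ` E'"
    then obtain e where e: "e \<in> E'" "q = (e, g e, b, b0)" by blast
    have "g e \<in> R" "g e \<notin> E" "ev \<Longrightarrow> g e \<noteq> a" using g e by (auto split: if_splits)
    then show ?thesis
      using e E E' F b0 by (auto simp: odd_block_def cross_sign_def cells_def)
  next
    assume "q \<in> (\<lambda>f. (a, a0, f, h f)) ` F"
    then obtain f where f: "f \<in> F" "q = (a, a0, f, h f)" by blast
    have "h f \<in> C" "h f \<notin> F" "h f \<noteq> b" using h f by auto
    then show ?thesis
      using f E F a0 by (auto simp: odd_block_def cross_sign_def cells_def)
  qed
  moreover have "finite T" by (simp add: T_def finE finF)
  ultimately show ?thesis unfolding has_odd_blocks_def by blast
qed

section \<open>The sign pattern of the hypergraph state across a bipartition\<close>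

definition ones :: "nat set \<Rightarrow> label" where
  "ones Q = restrict (\<lambda>_. True) Q"

definition one_zero :: "nat set \<Rightarrow> label set" where
  "one_zero Q = (\<lambda>i. (ones Q)(i := False)) ` Q"

lemma ones_in_labels: "ones Q \<in> labels Q"
  by (simp add: ones_def labels_def)

lemma one_zero_subset_labels: "one_zero Q \<subseteq> labels Q"
  by (auto simp: one_zero_def ones_def labels_def PiE_iff extensional_def split: if_splits)

lemma ones_notin_one_zero: "ones Q \<notin> one_zero Q"
proof
  assume "ones Q \<in> one_zero Q"
  then obtain i where "i \<in> Q" "ones Q = (ones Q)(i := False)" by (auto simp: one_zero_def)
  then have "\<not> ones Q i" by (metis fun_upd_same)
  with \<open>i \<in> Q\<close> show False by (simp add: ones_def)
qed

lemma card_labels: "finite Q \<Longrightarrow> card (labels Q) = 2 ^ card Q"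
  by (simp add: labels_def card_PiE)

lemma card_one_zero: "card (one_zero Q) = card Q"
  unfolding one_zero_def
  by (rule card_image) (auto simp: inj_on_def ones_def fun_eq_iff split: if_splits)

text \<open>The gate omitting qubit i flips the sign iff all other qubits are 1. The number m of
  such i is n at the all-ones label, 1 at a label with a single 0, and 0 elsewhere. The full gate
  adds one more flip at the all-ones label, whose sign is therefore (-1)^(n+1).\<close>

lemma hypergraph_state_eq:
  assumes n: "n \<ge> 2" and x: "x \<in> labels {1..n}"
  shows "hypergraph_state n x = complex_of_real
    ((if x \<in> one_zero {1..n} \<or> even n \<and> x = ones {1..n} then -1 else 1) / sqrt 2 ^ n)"
proof -
  let ?Q = "{1..n}"
  have fold: "foldr (\<lambda>i. CZ (?Q - {i})) is \<psi> x
      = (-1) ^ length (filter (\<lambda>i. \<forall>j\<in>?Q - {i}. x j) is) * \<psi> x" for "is" \<psi>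
    by (induction "is") (simp_all add: CZ_def)
  have plus: "plus_state n x = complex_of_real (1 / sqrt 2 ^ n)"
    by (simp add: plus_state_def plus_ket_def power_divide)
  have ones: "x = ones ?Q \<longleftrightarrow> (\<forall>j\<in>?Q. x j)"
    using x by (auto simp: ones_def labels_def PiE_iff extensional_def fun_eq_iff)
  have len: "length (filter (\<lambda>i. \<forall>j\<in>?Q - {i}. x j) [1..<Suc n])
      = card {i\<in>?Q. \<forall>j\<in>?Q - {i}. x j}"
    by (subst distinct_card[symmetric]) (auto intro!: arg_cong[where f = card])
  define m where "m = card {i\<in>?Q. \<forall>j\<in>?Q - {i}. x j}"
  have state: "hypergraph_state n x =
      (if x = ones ?Q then -1 else 1) * ((-1) ^ m * complex_of_real (1 / sqrt 2 ^ n))"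
    unfolding hypergraph_state_def CZ_def[of ?Q] fold len plus ones m_def by simp
  consider "x = ones ?Q" | "x \<noteq> ones ?Q" "x \<in> one_zero ?Q" | "x \<noteq> ones ?Q" "x \<notin> one_zero ?Q"
    by blast
  then show ?thesis
  proof cases
    case 1
    then have all: "\<forall>j\<in>?Q. x j" using ones by blast
    then have "{i\<in>?Q. \<forall>j\<in>?Q - {i}. x j} = ?Q" by blast
    then have "m = n" by (simp add: m_def del: One_nat_def)
    moreover have "x \<notin> one_zero ?Q" using 1 ones_notin_one_zero by metis
    ultimately show ?thesis unfolding state using 1 by simp
  next
    case 2
    then obtain i where i: "i \<in> ?Q" "x = (ones ?Q)(i := False)" by (auto simp: one_zero_def)
    have "{k\<in>?Q. \<forall>j\<in>?Q - {k}. x j} = {i}" using i by (auto simp: ones_def)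
    then have "m = 1" by (simp only: m_def) simp
    then show ?thesis unfolding state using 2 by simp
  next
    case 3
    have "x = (ones ?Q)(i := False)" if "i \<in> ?Q" "\<forall>j\<in>?Q - {i}. x j" for i
    proof -
      have "\<not> x i" using 3(1) ones that by blast
      then show ?thesis
        using that x by (auto simp: ones_def labels_def PiE_iff extensional_def fun_eq_iff)
    qed
    then have "{i\<in>?Q. \<forall>j\<in>?Q - {i}. x j} = {}" using 3(2) unfolding one_zero_def by blast
    then have "m = 0" by (simp only: m_def) simp
    then show ?thesis unfolding state using 3 by simp
  qed
qed

lemma bij_betw_split_label:
  assumes "A \<inter> B = {}"
  shows "bij_betw (\<lambda>x. (restrict x A, restrict x B)) (labels (A \<union> B)) (labels A \<times> labels B)"
proof (rule bij_betw_byWitness[where f' = "\<lambda>(y, z) j. if j \<in> A then y j else if j \<in> B then z j else undefined"])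
qed (use assms in \<open>auto simp: labels_def PiE_iff extensional_def fun_eq_iff restrict_def\<close>)

lemma ones_Un_iff:
  assumes "x \<in> labels (A \<union> B)"
  shows "x = ones (A \<union> B) \<longleftrightarrow> restrict x A = ones A \<and> restrict x B = ones B"
  using assms
  by (auto simp: ones_def labels_def PiE_iff extensional_def fun_eq_iff restrict_def)

text \<open>The single 0 lies on one side, and the other side is then all ones. This is what
  confines the entries -1 to a cross.\<close>

lemma one_zero_Un_iff:
  assumes "x \<in> labels (A \<union> B)" "A \<inter> B = {}"
  shows "x \<in> one_zero (A \<union> B) \<longleftrightarrow>
    restrict x A \<in> one_zero A \<and> restrict x B = ones B \<or> restrict x A = ones A \<and> restrict x B \<in> one_zero B"
proof -
  have one: "y \<in> one_zero Q \<longleftrightarrow> (\<exists>i\<in>Q. \<forall>j\<in>Q. y j \<longleftrightarrow> j \<noteq> i)" if "y \<in> labels Q" for y Q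
    using that
    by (auto simp: one_zero_def ones_def labels_def PiE_iff extensional_def fun_eq_iff image_iff Bex_def)
  have all: "y = ones Q \<longleftrightarrow> (\<forall>j\<in>Q. y j)" if "y \<in> labels Q" for y Q
    using that by (auto simp: ones_def labels_def PiE_iff extensional_def fun_eq_iff)
  have restr: "restrict x A \<in> labels A" "restrict x B \<in> labels B"
    by (simp_all add: labels_def)
  have restr_iff: "(\<forall>j\<in>Q. restrict x Q j \<longleftrightarrow> j \<noteq> i) \<longleftrightarrow> (\<forall>j\<in>Q. x j \<longleftrightarrow> j \<noteq> i)"
    "(\<forall>j\<in>Q. restrict x Q j) \<longleftrightarrow> (\<forall>j\<in>Q. x j)" for Q i
    by simp_all
  show ?thesis
    unfolding one[OF assms(1)] one[OF restr(1)] one[OF restr(2)] all[OF restr(1)] all[OF restr(2)]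
      restr_iff
  proof
    assume "\<exists>i\<in>A \<union> B. \<forall>j\<in>A \<union> B. x j \<longleftrightarrow> j \<noteq> i"
    then obtain i where i: "i \<in> A \<union> B" "\<forall>j\<in>A \<union> B. x j \<longleftrightarrow> j \<noteq> i" by blast
    show "(\<exists>i\<in>A. \<forall>j\<in>A. x j \<longleftrightarrow> j \<noteq> i) \<and> (\<forall>j\<in>B. x j)
      \<or> (\<forall>j\<in>A. x j) \<and> (\<exists>i\<in>B. \<forall>j\<in>B. x j \<longleftrightarrow> j \<noteq> i)"
    proof (cases "i \<in> A")
      case True
      then have "\<forall>j\<in>B. x j" using i(2) assms(2) by (metis UnI2 disjoint_iff)
      then show ?thesis using True i(2) by auto
    next
      case False
      then have "\<forall>j\<in>A. x j" using i(2) by (metis UnI1)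
      then show ?thesis using False i by auto
    qed
  next
    assume "(\<exists>i\<in>A. \<forall>j\<in>A. x j \<longleftrightarrow> j \<noteq> i) \<and> (\<forall>j\<in>B. x j)
      \<or> (\<forall>j\<in>A. x j) \<and> (\<exists>i\<in>B. \<forall>j\<in>B. x j \<longleftrightarrow> j \<noteq> i)"
    then show "\<exists>i\<in>A \<union> B. \<forall>j\<in>A \<union> B. x j \<longleftrightarrow> j \<noteq> i"
    proof (elim disjE conjE bexE)
      fix i assume "i \<in> A" "\<forall>j\<in>A. x j \<longleftrightarrow> j \<noteq> i" "\<forall>j\<in>B. x j"
      then show ?thesis using assms(2) by (intro bexI[of _ i]) auto
    next
      fix i assume "i \<in> B" "\<forall>j\<in>B. x j \<longleftrightarrow> j \<noteq> i" "\<forall>j\<in>A. x j"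
      then show ?thesis using assms(2) by (intro bexI[of _ i]) auto
    qed
  qed
qed

lemma braket_hypergraph_state:
  assumes n: "n \<ge> 2" and AB: "bipartition n A B"
  shows "braket (A \<union> B) (tensor A B \<phi> \<eta>) (hypergraph_state n) =
    (\<Sum>(y, z)\<in>labels A \<times> labels B. cnj (\<phi> y * \<eta> z)
       * cross_sign (even n) (one_zero A) (ones A) (one_zero B) (ones B) y z) / sqrt 2 ^ n"
proof -
  have Q: "A \<union> B = {1..n}" and disj: "A \<inter> B = {}" using AB by (auto simp: bipartition_def)
  have "braket (A \<union> B) (tensor A B \<phi> \<eta>) (hypergraph_state n) =
    (\<Sum>x\<in>labels (A \<union> B). case (restrict x A, restrict x B) of (y, z) \<Rightarrow> cnj (\<phi> y * \<eta> z)
       * cross_sign (even n) (one_zero A) (ones A) (one_zero B) (ones B) y z / sqrt 2 ^ n)"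
    unfolding braket_def
  proof (rule sum.cong[OF refl])
    fix x assume x: "x \<in> labels (A \<union> B)"
    have "hypergraph_state n x = cross_sign (even n) (one_zero A) (ones A) (one_zero B) (ones B)
        (restrict x A) (restrict x B) / sqrt 2 ^ n"
      using hypergraph_state_eq[OF n, of x] x one_zero_Un_iff[OF x disj] ones_Un_iff[OF x]
      unfolding Q by (auto simp: cross_sign_def)
    then show "cnj (tensor A B \<phi> \<eta> x) * hypergraph_state n x =
      (case (restrict x A, restrict x B) of (y, z) \<Rightarrow> cnj (\<phi> y * \<eta> z)
       * cross_sign (even n) (one_zero A) (ones A) (one_zero B) (ones B) y z / sqrt 2 ^ n)"
      by (simp add: tensor_def)
  qed
  also have "\<dots> = (\<Sum>(y, z)\<in>labels A \<times> labels B. cnj (\<phi> y * \<eta> z)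
       * cross_sign (even n) (one_zero A) (ones A) (one_zero B) (ones B) y z / sqrt 2 ^ n)"
    by (rule sum.reindex_bij_betw[OF bij_betw_split_label[OF disj]])
  finally show ?thesis by (simp only: case_prod_unfold sum_divide_distrib)
qed

section \<open>The upper bound for every bipartition\<close>

text \<open>This symmetry allows the upper bound to be proved only for
  \<open>card A \<le> card B\<close>.\<close>

lemma overlaps_commute: "overlaps A B \<psi> = overlaps B A \<psi>"
proof -
  have "overlaps A B \<psi> \<subseteq> overlaps B A \<psi>" for A B
  proof
    fix v assume "v \<in> overlaps A B \<psi>"
    then obtain \<phi> \<eta> where v: "v = (cmod (braket (A \<union> B) (tensor A B \<phi> \<eta>) \<psi>))\<^sup>2"
      and nrm: "normalized A \<phi>" "normalized B \<eta>"
      unfolding overlaps_def by blast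
    have "tensor A B \<phi> \<eta> = tensor B A \<eta> \<phi>" by (simp add: tensor_def mult.commute)
    then have "v = (cmod (braket (B \<union> A) (tensor B A \<eta> \<phi>) \<psi>))\<^sup>2"
      by (simp only: v Un_commute)
    with nrm show "v \<in> overlaps B A \<psi>" unfolding overlaps_def by blast
  qed
  then show ?thesis by blast
qed

text \<open>Provides enough partner rows outside \<open>one_zero A\<close>.\<close>

lemma two_mult_le_power2: "2 * k \<le> (2::nat) ^ k"
  proof (cases k)
  case (Suc j)
  then show ?thesis using Suc_leI[OF less_exp[of j]] by simp
qed simp

text \<open>Provides the columns required by \<open>has_odd_blocks_cross_sign\<close>. The
  inequality fails for l = 2, which is why small B is treated separately.\<close>

lemma two_mult_add_two_le_power2: "l \<ge> 3 \<Longrightarrow> 2 * l + 2 \<le> (2::nat) ^ l"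
  by (induction l rule: dec_induct) auto

text \<open>The case n = 3 is exceptional because three disjoint blocks would occupy 12 entries,
  while the matrix has only 8.\<close>

definition block_count :: "nat \<Rightarrow> nat" where
  "block_count n = (if n = 3 then 1 else if even n then n - 1 else n)"

text \<open>The general construction applies once B has at least three qubits. The remaining sizes
  (1,1), (1,2) and (2,2) get explicit blocks.\<close>

lemma has_odd_blocks_bipartition:
  assumes n: "n \<ge> 2" and AB: "bipartition n A B" and le: "card A \<le> card B"
  shows "has_odd_blocks (cross_sign (even n) (one_zero A) (ones A) (one_zero B) (ones B))
    (labels A) (labels B) (block_count n)"
proof -
  have fin: "finite A" "finite B" and pos: "card A \<ge> 1" "card B \<ge> 1" and sum: "card A + card B = n"
  proof -
    have "finite (A \<union> B)" using AB by (simp add: bipartition_def)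
    then show f: "finite A" "finite B" by simp_all
    then show "card A \<ge> 1" "card B \<ge> 1" using AB by (simp_all add: bipartition_def Suc_le_eq card_gt_0_iff)
    show "card A + card B = n" using f AB card_Un_disjoint[of A B] by (simp add: bipartition_def)
  qed
  let ?E = "one_zero A" and ?a = "ones A" and ?F = "one_zero B" and ?b = "ones B"
  have E: "?E \<subseteq> labels A" "?a \<in> labels A" "?a \<notin> ?E" "?E \<noteq> {}"
    and F: "?F \<subseteq> labels B" "?b \<in> labels B" "?b \<notin> ?F"
    using pos card_one_zero[of A] by (auto simp: one_zero_subset_labels[THEN subsetD] ones_in_labels ones_notin_one_zero)
  have finE: "finite ?E" "finite ?F" using fin by (simp_all add: one_zero_def)
  have card_rest: "card (labels A - ?E) = 2 ^ card A - card A"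
    "card (labels A - ?E - {?a}) = 2 ^ card A - card A - 1"
    using E fin finE by (simp_all add: card_Diff_subset card_labels card_one_zero)
  show ?thesis
  proof (cases "card B \<ge> 3")
    case True
    \<comment> \<open>For even n the partner rows also avoid the all-ones row, and for one or two
      qubits in A only \<open>card A - 1\<close> of them remain; hence one row of \<open>?E\<close>
      is given up.\<close>
    have "card A - (if even n then 1 else 0) \<le> card ?E" by (simp add: card_one_zero)
    then obtain E' where E': "E' \<subseteq> ?E" "card E' = card A - (if even n then 1 else 0)"
      by (rule obtain_subset_with_card_n)
    have "card E' \<le> card (labels A - ?E - (if even n then {?a} else {}))"
      using E'(2) two_mult_le_power2[of "card A"] pos card_rest by auto
    moreover have "2 * card ?F + 2 \<le> card (labels B)"
      using two_mult_add_two_le_power2[OF True] fin by (simp add: card_one_zero card_labels)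
    ultimately have "has_odd_blocks (cross_sign (even n) ?E ?a ?F ?b) (labels A) (labels B)
        (card E' + card ?F)"
      using fin E F E'(1) by (intro has_odd_blocks_cross_sign) auto
    moreover have "card E' + card ?F = block_count n"
      using E'(2) sum True pos by (auto simp: block_count_def card_one_zero)
    ultimately show ?thesis by simp
  next
    case False
    with le pos consider "card A = 1" "card B = 1" | "card A = 1" "card B = 2" | "card A = 2" "card B = 2"
      by linarith
    then show ?thesis
    proof cases
      case 1
      then obtain e f where "?E = {e}" "?F = {f}"
        by (metis card_1_singletonE card_one_zero)
      \<comment> \<open>The block is the whole 2 by 2 matrix, with three entries -1.\<close>
      then show ?thesis
        unfolding has_odd_blocks_def using 1 sum E F
        by (intro exI[of _ "{(e, ?a, f, ?b)}"])
          (auto simp: block_count_def disjoint_family_on_def odd_block_def cross_sign_def cells_def)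
    next
      case 2
      then obtain e f f' where ef: "?E = {e}" "?F = {f, f'}"
        by (metis card_1_singletonE card_one_zero card_2_iff)
      have "card (labels B - ?F - {?b}) = 1"
        using 2 F fin finE by (simp add: card_Diff_subset card_labels card_one_zero)
      then obtain v where "labels B - ?F - {?b} = {v}" by (rule card_1_singletonE)
      then have "v \<in> labels B" "v \<notin> ?F" "v \<noteq> ?b" by auto
      then show ?thesis
        unfolding has_odd_blocks_def using 2 sum E F ef
        by (intro exI[of _ "{(e, ?a, f, v)}"])
          (auto simp: block_count_def disjoint_family_on_def odd_block_def cross_sign_def cells_def)
    next
      case 3
      then obtain e e' f f' where ef: "?E = {e, e'}" "e \<noteq> e'" "?F = {f, f'}" "f \<noteq> f'"
        by (metis card_one_zero card_2_iff)
      have "card (labels B - ?F - {?b}) = 1"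
        using 3 F fin finE by (simp add: card_Diff_subset card_labels card_one_zero)
      then obtain v where "labels B - ?F - {?b} = {v}" by (rule card_1_singletonE)
      then have v: "v \<in> labels B" "v \<notin> ?F" "v \<noteq> ?b" by auto
      have "card (labels A - ?E - {?a}) = 1" using 3 card_rest by simp
      then obtain u where "labels A - ?E - {?a} = {u}" by (rule card_1_singletonE)
      then have u: "u \<in> labels A" "u \<notin> ?E" "u \<noteq> ?a" by auto
      \<comment> \<open>Here n = 4 and the matrix has five entries -1. The first block takes three
        of them, including the corner (\<open>?a\<close>, \<open>?b\<close>), and the other two
        blocks take one each.\<close>
      show ?thesis
        unfolding has_odd_blocks_def using 3 sum E F ef u v
        by (intro exI[of _ "{(?a, e, f, ?b), (?a, u, f', v), (e', u, ?b, f)}"])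
          (auto simp: block_count_def disjoint_family_on_def odd_block_def cross_sign_def cells_def)
    qed
  qed
qed

lemma overlap_max_le:
  assumes n: "n \<ge> 2" and AB: "bipartition n A B" and le: "card A \<le> card B"
  shows "overlap_max A B (hypergraph_state n) \<le> 1 - 2 * real (block_count n) / 2 ^ n"
proof -
  have fin: "finite A" "finite B" and sum: "card A + card B = n"
  proof -
    have "finite (A \<union> B)" using AB by (simp add: bipartition_def)
    then show f: "finite A" "finite B" by simp_all
    show "card A + card B = n" using f AB card_Un_disjoint[of A B] by (simp add: bipartition_def)
  qed
  obtain \<phi> \<eta> where v: "overlap_max A B (hypergraph_state n)
      = (cmod (braket (A \<union> B) (tensor A B \<phi> \<eta>) (hypergraph_state n)))\<^sup>2"
    and nrm: "normalized A \<phi>" "normalized B \<eta>"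
    using overlap_max_attained(1)[OF fin] unfolding overlaps_def by blast
  have "overlap_max A B (hypergraph_state n) * 2 ^ n
      = (cmod (\<Sum>(y, z)\<in>labels A \<times> labels B. cnj (\<phi> y * \<eta> z)
       * cross_sign (even n) (one_zero A) (ones A) (one_zero B) (ones B) y z))\<^sup>2"
    unfolding v braket_hypergraph_state[OF n AB]
    by (simp add: norm_divide norm_power power_divide power_mult[symmetric] mult.commute[of n 2])
       (simp add: power_mult)
  also have "\<dots> \<le> card (labels A) * card (labels B) - 2 * real (block_count n)"
    using nrm fin
    by (intro product_overlap_le has_odd_blocks_bipartition[OF n AB le])
      (auto simp: normalized_iff cross_sign_cases)
  also have "\<dots> = 2 ^ n - 2 * real (block_count n)"
    using fin by (simp add: card_labels sum[symmetric] power_add)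
  finally show ?thesis by (simp add: field_simps)
qed

section \<open>Attaining the bound by splitting off one qubit\<close>

lemma bipartition_commute: "bipartition n A B \<longleftrightarrow> bipartition n B A"
  by (auto simp: bipartition_def)

lemma overlap_max_commute: "overlap_max A B \<psi> = overlap_max B A \<psi>"
  by (simp add: overlap_max_def overlaps_commute)

text \<open>The test state is (1, \<sigma>) / sqrt 2 on the single qubit, tensored with the
  normalized restriction of the first row of S to D. On D the two rows agree up to \<sigma>, so all
  terms add up in phase.\<close>

lemma overlap_max_singleton_ge:
  fixes \<sigma> :: real and n :: nat
  defines "S \<equiv> cross_sign (even n) (one_zero {1}) (ones {1}) (one_zero {2..n}) (ones {2..n})"
  assumes n: "n \<ge> 2" and \<sigma>: "\<sigma> = 1 \<or> \<sigma> = -1"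
    and D: "D = {z \<in> labels {2..n}. S ((ones {1})(1 := False)) z = \<sigma> * S (ones {1}) z}" "D \<noteq> {}"
  shows "2 * real (card D) / 2 ^ n \<le> overlap_max {1} {2..n} (hypergraph_state n)"
proof -
  define y0 where "y0 = (ones {1::nat})(1 := False)"
  define y1 where "y1 = ones {1::nat}"
  have ne: "y0 \<noteq> y1" by (auto simp: y0_def y1_def ones_def fun_eq_iff)
  have "{y0, y1} \<subseteq> labels {1}" using ones_in_labels one_zero_subset_labels
    by (auto simp: y0_def y1_def one_zero_def)
  then have labels1: "labels {1} = {y0, y1}"
    using ne by (intro card_subset_eq[symmetric]) (auto simp: card_labels)
  have AB: "bipartition n {1} {2..n}" using n by (auto simp: bipartition_def)
  have finD: "finite D" using D by simp
  have pos: "real (card D) > 0" using finD D by (simp add: card_gt_0_iff)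
  have S: "S y z = 1 \<or> S y z = -1" for y z by (simp add: S_def cross_sign_cases)
  define \<phi> :: qvec where "\<phi> = (\<lambda>y. complex_of_real (if y = y1 then \<sigma> / sqrt 2 else 1 / sqrt 2))"
  define \<eta> :: qvec where "\<eta> = (\<lambda>z. complex_of_real (if z \<in> D then S y0 z / sqrt (card D) else 0))"
  have "normalized {1} \<phi>"
    unfolding normalized_iff labels1 using ne \<sigma>
    by (auto simp: \<phi>_def norm_divide power_divide)
  moreover have "normalized {2..n} \<eta>"
  proof -
    have "(\<Sum>z\<in>labels {2..n}. (cmod (\<eta> z))\<^sup>2) = (\<Sum>z\<in>D. 1 / real (card D))"
    proof (rule sum.mono_neutral_cong_right)
      fix z assume "z \<in> D"
      then show "(cmod (\<eta> z))\<^sup>2 = 1 / real (card D)"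
        using S[of y0 z] by (auto simp: \<eta>_def norm_divide power_divide)
    qed (use D in \<open>auto simp: \<eta>_def\<close>)
    also have "\<dots> = 1" using pos by simp
    finally show ?thesis by (simp add: normalized_iff)
  qed
  ultimately have "(cmod (braket ({1} \<union> {2..n}) (tensor {1} {2..n} \<phi> \<eta>) (hypergraph_state n)))\<^sup>2
      \<in> overlaps {1} {2..n} (hypergraph_state n)"
    unfolding overlaps_def by blast
  then have ge: "(cmod (braket ({1} \<union> {2..n}) (tensor {1} {2..n} \<phi> \<eta>) (hypergraph_state n)))\<^sup>2
      \<le> overlap_max {1} {2..n} (hypergraph_state n)"
    by (intro overlap_max_attained(2)) auto
  have "(\<Sum>(y, z)\<in>labels {1} \<times> labels {2..n}. cnj (\<phi> y * \<eta> z) * S y z)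
      = (\<Sum>z\<in>labels {2..n}. cnj (\<phi> y0 * \<eta> z) * S y0 z + cnj (\<phi> y1 * \<eta> z) * S y1 z)"
    unfolding sum.cartesian_product[symmetric] labels1 using ne by (simp add: sum.distrib)
  \<comment> \<open>Columns outside D drop out since \<eta> vanishes there; inside D both rows
    contribute equally because \<sigma> squares to 1.\<close>
  also have "\<dots> = (\<Sum>z\<in>D. complex_of_real (2 / (sqrt 2 * sqrt (card D))))"
  proof (rule sum.mono_neutral_cong_right)
    fix z assume "z \<in> D"
    then have "S y0 z = \<sigma> * S y1 z" by (simp add: D y0_def y1_def)
    then show "cnj (\<phi> y0 * \<eta> z) * S y0 z + cnj (\<phi> y1 * \<eta> z) * S y1 z
        = complex_of_real (2 / (sqrt 2 * sqrt (card D)))"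
      using ne \<sigma> S[of y1 z] \<open>z \<in> D\<close> by (elim disjE) (auto simp: \<phi>_def \<eta>_def)
  qed (use D in \<open>auto simp: \<eta>_def\<close>)
  also have "\<dots> = complex_of_real (card D * (2 / (sqrt 2 * sqrt (card D))))"
    by simp
  finally have "braket ({1} \<union> {2..n}) (tensor {1} {2..n} \<phi> \<eta>) (hypergraph_state n)
      = complex_of_real (card D * (2 / (sqrt 2 * sqrt (card D))) / sqrt 2 ^ n)"
    unfolding braket_hypergraph_state[OF n AB] S_def by simp
  then have "(cmod (braket ({1} \<union> {2..n}) (tensor {1} {2..n} \<phi> \<eta>) (hypergraph_state n)))\<^sup>2
      = (card D * (2 / (sqrt 2 * sqrt (card D))) / sqrt 2 ^ n)\<^sup>2"
    by (simp only: norm_of_real power2_abs)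
  also have "\<dots> = (real (card D))\<^sup>2 * (4 / (2 * card D)) / (sqrt 2 ^ n)\<^sup>2"
    by (simp add: power_mult_distrib power_divide)
  also have "(sqrt 2 ^ n)\<^sup>2 = (2::real) ^ n"
    by (simp add: power_mult[symmetric] mult.commute[of n 2]) (simp add: power_mult)
  also have "(real (card D))\<^sup>2 * (4 / (2 * card D)) = 2 * real (card D)"
    using pos by (simp add: power2_eq_square)
  finally show ?thesis using ge by simp
qed

lemma alpha_hypergraph_state:
  assumes n: "n \<ge> 2"
  shows "alpha n (hypergraph_state n) = 1 - 2 * real (block_count n) / 2 ^ n"
  unfolding alpha_def
proof (rule Max_eqI)
  let ?M = "{overlap_max A B (hypergraph_state n) | A B. bipartition n A B}"
  have "?M \<subseteq> (\<lambda>(A, B). overlap_max A B (hypergraph_state n)) ` (Pow {1..n} \<times> Pow {1..n})"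
    by (auto simp: bipartition_def)
  then show "finite ?M" by (rule finite_subset) simp
  have upper: "v \<le> 1 - 2 * real (block_count n) / 2 ^ n" if "v \<in> ?M" for v
  proof -
    obtain A B where "bipartition n A B" "v = overlap_max A B (hypergraph_state n)"
      using \<open>v \<in> ?M\<close> by blast
    then show ?thesis
      using overlap_max_le[OF n, of A B] overlap_max_le[OF n, of B A]
      by (metis bipartition_commute overlap_max_commute nat_le_linear)
  qed
  then show "v \<le> 1 - 2 * real (block_count n) / 2 ^ n" if "v \<in> ?M" for v using that .
  let ?B = "{2..n}" and ?y = "(ones {1})(1 := False)"
  define S where "S = cross_sign (even n) (one_zero {1}) (ones {1}) (one_zero ?B) (ones ?B)"
  \<comment> \<open>For n = 3 the two rows differ in three of the four columns, so the larger
    overlap comes from the columns where they disagree.\<close>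
  define \<sigma> :: real where "\<sigma> = (if n = 3 then -1 else 1)"
  define D where "D = {z \<in> labels ?B. S ?y z = \<sigma> * S (ones {1}) z}"
  have y: "?y \<noteq> ones {1}" "ones {1} \<notin> one_zero {1}" "one_zero {1} = {?y}"
    using ones_notin_one_zero[of "{1}"] by (auto simp: one_zero_def)
  have F: "one_zero ?B \<subseteq> labels ?B" "ones ?B \<in> labels ?B" "ones ?B \<notin> one_zero ?B" "finite (one_zero ?B)"
    by (simp_all add: one_zero_subset_labels ones_in_labels ones_notin_one_zero)
       (simp add: one_zero_def)
  \<comment> \<open>The discarded columns are exactly as many as the odd blocks, so the lower bound
    meets the upper one. For n different from 3 the rows differ on \<open>one_zero ?B\<close>, and
    for odd n also at \<open>ones ?B\<close>.\<close>
  have "card D + block_count n = 2 ^ (n - 1)"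
  proof (cases "n = 3")
    case True
    then have "D = insert (ones ?B) (one_zero ?B)"
      using F y by (auto simp: D_def S_def \<sigma>_def cross_sign_def)
    then show ?thesis using F True by (simp add: card_one_zero block_count_def)
  next
    case False
    then have "D = labels ?B - (one_zero ?B \<union> (if even n then {} else {ones ?B}))"
      using F y by (auto simp: D_def S_def \<sigma>_def cross_sign_def)
    moreover have "card (one_zero ?B \<union> (if even n then {} else {ones ?B})) = block_count n"
      using F n False by (auto simp: card_one_zero block_count_def)
    moreover have "card (one_zero ?B \<union> (if even n then {} else {ones ?B})) \<le> card (labels ?B)"
      using F by (intro card_mono) auto
    ultimately show ?thesis
      using F n by (simp add: card_Diff_subset card_labels)
  qed
  \<comment> \<open>This makes D nonempty, so that the test state can be normalized.\<close>
  moreover have "block_count n < 2 ^ (n - 1)"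
  proof (cases "even n \<or> n = 3")
    case True
    then show ?thesis using less_exp[of "n - 1"] n by (auto simp: block_count_def)
  next
    case False
    then have "n - 1 \<ge> 3" using n by presburger
    then show ?thesis using two_mult_add_two_le_power2[of "n - 1"] n False
      by (simp add: block_count_def)
  qed
  moreover from calculation have "real (card D) + real (block_count n) = 2 ^ (n - 1)"
    by (metis of_nat_add of_nat_numeral of_nat_power)
  ultimately have D: "D \<noteq> {}" "real (card D) = 2 ^ (n - 1) - real (block_count n)"
    by auto
  have "2 * real (card D) / 2 ^ n \<le> overlap_max {1} ?B (hypergraph_state n)"
    using overlap_max_singleton_ge[OF n, of \<sigma> D] D(1) by (auto simp: D_def S_def \<sigma>_def)
  also have "2 * real (card D) / 2 ^ n = 1 - 2 * real (block_count n) / 2 ^ n"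
    using n by (simp add: D(2) field_simps power_eq_if[of 2 n])
  finally have ge: "1 - 2 * real (block_count n) / 2 ^ n \<le> overlap_max {1} ?B (hypergraph_state n)" .
  have "bipartition n {1} ?B" using n by (auto simp: bipartition_def)
  then have mem: "overlap_max {1} ?B (hypergraph_state n) \<in> ?M" by blast
  with upper ge have "1 - 2 * real (block_count n) / 2 ^ n = overlap_max {1} ?B (hypergraph_state n)"
    by force
  with mem show "1 - 2 * real (block_count n) / 2 ^ n \<in> ?M" by (simp only:)
qed

theorem mainTheorem2:
  shows "alpha 3 (hypergraph_state 3) = 3 / 4
    \<and> (\<forall>n::nat. n \<ge> 2 \<and> even n \<longrightarrow>
         alpha n (hypergraph_state n) = (2 ^ (n - 1) - real n + 1) / 2 ^ (n - 1))
    \<and> (\<forall>n::nat. n \<ge> 5 \<and> odd n \<longrightarrow>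
         alpha n (hypergraph_state n) = (2 ^ (n - 1) - real n) / 2 ^ (n - 1))
    \<and> entanglement 3 (hypergraph_state 3) = 1 / 4
    \<and> (\<forall>n::nat. n \<ge> 2 \<and> even n \<longrightarrow>
         entanglement n (hypergraph_state n) = (real n - 1) / 2 ^ (n - 1))
    \<and> (\<forall>n::nat. n \<ge> 5 \<and> odd n \<longrightarrow>
         entanglement n (hypergraph_state n) = real n / 2 ^ (n - 1))"
proof -
  have pow: "(2::real) ^ n = 2 * 2 ^ (n - 1)" if "n \<ge> 2" for n :: nat
    using that by (cases n) auto
  show ?thesis
    by (simp add: entanglement_def alpha_hypergraph_state pow block_count_def of_nat_diff field_simps)
qed

end
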